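(* Let $r\in\mathbb N$, let $G$ be an abelian group, and let $\mathcal A=(A_1,\dots,A_q)$ where for each $i$, $A_i=a_i+M_i$ with $a_i\in G$ and $M_i\subseteq G$ a submonoid (i.e. $0\in M_i$ and $M_i+M_i\subseteq M_i$). Then for every $\mathbf h=(h_1,\dots,h_q)\in\mathbb N_0^q$, \[ (r\mathbf h)\cdot\mathcal A=(r-1)\sum_{i=1}^q h_ia_i+\mathbf h\cdot\mathcal A. \] Consequently $\mathcal A$ is a chromatic $(r,1)$-approximate group.
   Context: $\mathbb N=\{1,2,\dots\}$, $\mathbb N_0=\{0,1,2,\dots\}$. For subsets $X,Y$ of an abelian group, $X+Y=\{x+y:x\in X,y\in Y\}$, and $x+Y=\{x\}+Y$; for $h\in\mathbb N$, $hA$ is the $h$-fold sumset $A+\cdots+A$ and $0A=\{0\}$. For $\mathbf h=(h_1,\dots,h_q)\in\mathbb N_0^q$, $\mathbf h\cdot\mathcal A=h_1A_1+\cdots+h_qA_q$ and $r\mathbf h=(rh_1,\dots,rh_q)$. A tuple $\mathcal A$ is a chromatic $(r,\ell)$-approximate group if for every $\mathbf h\in\mathbb N_0^q$ there is $X_{\mathbf h}\subseteq G$ with $|X_{\mathbf h}|\le\ell$ and $(r\mathbf h)\cdot\mathcal A\subseteq X_{\mathbf h}+\mathbf h\cdot\mathcal A$. *)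

theory Defs
  imports Main "HOL-Library.Set_Algebras"
begin

text \<open>
  Sumsets are those of \<^theory>\<open>HOL-Library.Set_Algebras\<close>, where the subsets of a
  commutative monoid again form a commutative monoid with neutral element \<open>{0}\<close>.
  Hence \<open>nfold\<close> is both the multiple \<open>n x\<close> of an element and, at a set type,
  the \<open>n\<close>-fold sumset, with \<open>nfold 0 A = {0}\<close>.
\<close>

definition nfold :: "nat \<Rightarrow> 'a::comm_monoid_add \<Rightarrow> 'a" where
  "nfold n x = (\<Sum>_<n. x)"

definition submonoid_set :: "'a::ab_group_add set \<Rightarrow> bool" where
  "submonoid_set M \<longleftrightarrow> 0 \<in> M \<and> M + M \<subseteq> M"

text \<open>
  A \<open>q\<close>-tuple is a function on \<open>nat\<close>, of which only the values on \<open>{1..q}\<close> matter.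
\<close>

definition chromatic_sumset :: "nat \<Rightarrow> (nat \<Rightarrow> nat) \<Rightarrow> (nat \<Rightarrow> 'a::ab_group_add set) \<Rightarrow> 'a set" where
  "chromatic_sumset q h A = (\<Sum>i=1..q. nfold (h i) (A i))"

definition chromatic_approx_group ::
    "nat \<Rightarrow> nat \<Rightarrow> nat \<Rightarrow> (nat \<Rightarrow> 'a::ab_group_add set) \<Rightarrow> bool" where
  "chromatic_approx_group r l q A \<longleftrightarrow>
     (\<forall>h. \<exists>X. finite X \<and> card X \<le> l \<and>
        chromatic_sumset q (\<lambda>i. r * h i) A \<subseteq> X + chromatic_sumset q h A)"

end

theory Submission
  imports Defs
begin

text \<open>
  A nonempty multiple of a submonoid is the submonoid itself, so for \<open>n > 0\<close> the \<open>n\<close>-fold sumset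
  of \<open>a + M\<close> is \<open>n a + M\<close>. Passing from \<open>n = h\<^sub>i\<close> to \<open>n = r h\<^sub>i\<close> therefore only translates by
  \<open>(r - 1) h\<^sub>i a\<^sub>i\<close>; this also holds for \<open>h\<^sub>i = 0\<close>, where both sumsets are \<open>{0}\<close>. Summing over \<open>i\<close>
  gives the claim.
\<close>

lemma nfold_0 [simp]: "nfold 0 x = 0"
  by (simp add: nfold_def)

lemma nfold_Suc [simp]: "nfold (Suc n) x = nfold n x + x"
  by (simp add: nfold_def)

lemma nfold_zero_right [simp]: "nfold n 0 = 0"
  by (simp add: nfold_def)

lemma nfold_add_left: "nfold (m + n) x = nfold m x + nfold n x"
  by (induction n) (simp_all add: add.assoc)

text \<open>Used at the set type, where it splits \<open>nfold n ({a} + M)\<close> into the multiple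
  of a singleton and that of a submonoid.\<close>

lemma nfold_add_right: "nfold n (x + y) = nfold n x + nfold n y"
  by (simp add: nfold_def sum.distrib)

lemma nfold_mult: "nfold (m * n) x = nfold m (nfold n x)"
  by (induction m) (simp_all add: nfold_add_left add.commute)

lemma nfold_sum: "nfold n (\<Sum>i\<in>I. f i) = (\<Sum>i\<in>I. nfold n (f i))"
  unfolding nfold_def by (rule sum.swap)

lemma singleton_plus_singleton: "{x} + {y} = {x + y}"
  by (auto simp: set_plus_def)

lemma nfold_singleton: "nfold n {x} = {nfold n x}"
  by (induction n) (simp_all add: singleton_plus_singleton set_zero)

lemma sum_singletons: "(\<Sum>i\<in>I. {f i}) = {\<Sum>i\<in>I. f i}"
  by (induction I rule: infinite_finite_induct)
    (simp_all add: singleton_plus_singleton set_zero)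

lemma submonoid_set_add_self:
  assumes "submonoid_set M"
  shows "M + M = M"
proof
  show "M + M \<subseteq> M"
    using assms by (simp add: submonoid_set_def)
  show "M \<subseteq> M + M"
    using assms set_zero_plus2 [of M M] by (simp add: submonoid_set_def)
qed

text \<open>Induction from \<open>n = 1\<close>, each step absorbing one more copy of
  \<open>M\<close> by \<open>M + M = M\<close>. The case \<open>n = 0\<close> would give
  \<open>{0}\<close>.\<close>

lemma nfold_submonoid_set:
  assumes "submonoid_set M" and "n > 0"
  shows "nfold n M = M"
  using assms(2)
proof (induction n rule: nat_induct_non_zero)
  case (Suc n)
  then show ?case
    using submonoid_set_add_self [OF assms(1)] by simp
qed simp

lemma nfold_mult_translate_submonoid:
  assumes "submonoid_set M" and "r \<ge> 1"
  shows "nfold (r * n) ({a} + M) = {nfold (r - 1) (nfold n a)} + nfold n ({a} + M)"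
proof (cases "n = 0")
  case True
  then show ?thesis
    by (simp add: set_zero)
next
  case False
  have "r * n = (r - 1) * n + n"
    using \<open>r \<ge> 1\<close> by (cases r) auto
  then have "nfold (r * n) a = nfold (r - 1) (nfold n a) + nfold n a"
    by (simp only: nfold_add_left nfold_mult)
  then have "{nfold (r * n) a} + M = {nfold (r - 1) (nfold n a)} + ({nfold n a} + M)"
    by (simp only: add.assoc [symmetric] singleton_plus_singleton)
  \<comment> \<open>Both \<open>n\<close> and \<open>r * n\<close> are positive, so either multiple
    of \<open>M\<close> collapses to \<open>M\<close>.\<close>
  moreover have "r * n > 0"
    using False \<open>r \<ge> 1\<close> by simp
  ultimately show ?thesis
    using False assms(1)
    by (simp add: nfold_add_right nfold_singleton nfold_submonoid_set)
qed

theorem theorem1p13: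
  fixes r q :: nat
    and a :: "nat \<Rightarrow> 'a::ab_group_add"
    and M A :: "nat \<Rightarrow> 'a set"
  assumes "r \<ge> 1"
    and "\<And>i. i \<in> {1..q} \<Longrightarrow> submonoid_set (M i)"
    and "\<And>i. i \<in> {1..q} \<Longrightarrow> A i = {a i} + M i"
  shows "(\<forall>h :: nat \<Rightarrow> nat.
            chromatic_sumset q (\<lambda>i. r * h i) A =
              {nfold (r - 1) (\<Sum>i=1..q. nfold (h i) (a i))} + chromatic_sumset q h A)
         \<and> chromatic_approx_group r 1 q A"
proof -
  have eq: "chromatic_sumset q (\<lambda>i. r * h i) A =
      {nfold (r - 1) (\<Sum>i=1..q. nfold (h i) (a i))} + chromatic_sumset q h A"
    for h :: "nat \<Rightarrow> nat"
  proof -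
    have "chromatic_sumset q (\<lambda>i. r * h i) A =
        (\<Sum>i=1..q. {nfold (r - 1) (nfold (h i) (a i))} + nfold (h i) (A i))"
      unfolding chromatic_sumset_def
      using assms by (intro sum.cong) (simp_all add: nfold_mult_translate_submonoid)
    then show ?thesis
      \<comment> \<open>Sets form a commutative monoid under sumset, so \<open>sum.distrib\<close>
        gathers the singletons, which add up to a single translation.\<close>
      by (simp add: chromatic_sumset_def sum.distrib sum_singletons nfold_sum)
  qed
  moreover have "chromatic_approx_group r 1 q A"
    unfolding chromatic_approx_group_def
  proof
    fix h :: "nat \<Rightarrow> nat"
    show "\<exists>X. finite X \<and> card X \<le> 1 \<and>
        chromatic_sumset q (\<lambda>i. r * h i) A \<subseteq> X + chromatic_sumset q h A"
      \<comment> \<open>The witness is the singleton of the translation in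
        \<open>eq\<close>.\<close>
      by (rule exI [of _ "{nfold (r - 1) (\<Sum>i=1..q. nfold (h i) (a i))}"]) (simp add: eq)
  qed
  ultimately show ?thesis
    by blast
qed

end
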